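(* There exist a real number $\epsilon>0$ and a set $N$ of positive integers of positive asymptotic density (i.e. $\liminf_{x\to\infty}|N\cap[x]|/x>0$) such that for every $n\in N$, $$\mathrm{ex}(n,C_4)\le \frac12 n^{3/2}+\left(\frac14-\epsilon\right)n.$$
   Context: $\mathrm{ex}(n,C_4)$ denotes the maximum number of edges in an $n$-vertex simple graph containing no cycle of length four as a subgraph. *)

theory Defs
  imports Complex_Main "HOL-Library.Extended_Real"
begin

definition simple_graph :: "'a set \<Rightarrow> 'a set set \<Rightarrow> bool" where
  "simple_graph V E \<longleftrightarrow> finite V \<and> (\<forall>e\<in>E. e \<subseteq> V \<and> card e = 2)"

text \<open>Subgraph containment, not necessarily induced: chords are allowed.\<close>

definition contains_C4 :: "'a set set \<Rightarrow> bool" where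
  "contains_C4 E \<longleftrightarrow>
     (\<exists>a b c d. distinct [a, b, c, d] \<and> {{a, b}, {b, c}, {c, d}, {d, a}} \<subseteq> E)"

definition C4_free_sizes :: "nat \<Rightarrow> nat set" where
  "C4_free_sizes n =
     {card E |(V :: nat set) E. simple_graph V E \<and> card V = n \<and> \<not> contains_C4 E}"

definition ex_C4 :: "nat \<Rightarrow> nat" where
  "ex_C4 n = Max (C4_free_sizes n)"

text \<open>
  The maximum is over a finite nonempty set, and restricting the vertices to natural
  numbers loses nothing: \<open>ex_C4_upper\<close> covers vertices of any type.
\<close>

lemma simple_graph_edges:
  assumes "simple_graph V E"
  shows "E \<subseteq> Pow V" "finite E" "card E \<le> 2 ^ card V"
proof -
  show sub: "E \<subseteq> Pow V" using assms by (auto simp: simple_graph_def)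
  have fin: "finite V" using assms by (simp add: simple_graph_def)
  show "finite E" using sub fin by (meson finite_Pow_iff finite_subset)
  show "card E \<le> 2 ^ card V"
    using card_mono[OF _ sub] fin by (simp add: card_Pow)
qed

lemma finite_C4_free_sizes: "finite (C4_free_sizes n)"
  by (rule finite_subset[of _ "{..2 ^ n}"])
     (auto simp: C4_free_sizes_def dest: simple_graph_edges(3))

lemma C4_free_sizes_nonempty: "C4_free_sizes n \<noteq> {}"
proof -
  have "card ({} :: nat set set) \<in> C4_free_sizes n"
    unfolding C4_free_sizes_def
    by (intro CollectI exI[of _ "{..<n}"] exI[of _ "{}"])
       (auto simp: simple_graph_def contains_C4_def)
  then show ?thesis by blast
qed

lemma ex_C4_upper:
  fixes V :: "'a set"
  assumes G: "simple_graph V E" and free: "\<not> contains_C4 E"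
  shows "card E \<le> ex_C4 (card V)"
proof -
  have "finite V" using G by (simp add: simple_graph_def)
  then have "\<exists>f :: 'a \<Rightarrow> nat. inj_on f V"
    using finite_imp_inj_to_nat_seg[of V] by fast
  then obtain f :: "'a \<Rightarrow> nat" where f: "inj_on f V" ..
  let ?E = "(`) f ` E"
  have EV: "E \<subseteq> Pow V" using simple_graph_edges(1)[OF G] .
  have "inj_on ((`) f) E"
    using inj_on_subset[OF inj_on_image_Pow[OF f] EV] .
  then have cardE: "card ?E = card E" by (rule card_image)
  have "card (f ` e) = 2" "f ` e \<subseteq> f ` V" if "e \<in> E" for e
    using that G card_image[OF inj_on_subset[OF f]] by (auto simp: simple_graph_def)
  then have G': "simple_graph (f ` V) ?E"
    using \<open>finite V\<close> by (auto simp: simple_graph_def)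
  have edge: "\<exists>x\<in>V. \<exists>y\<in>V. u = f x \<and> v = f y" if "{u, v} \<in> ?E" for u v
  proof -
    obtain e where e: "e \<in> E" "{u, v} = f ` e" using \<open>{u, v} \<in> ?E\<close> by (rule imageE)
    have "{u, v} \<subseteq> f ` V" unfolding e(2) using e(1) EV by (intro image_mono) auto
    then show ?thesis by (simp add: image_iff)
  qed
  have pull: "{x, y} \<in> E" if "{f x, f y} \<in> ?E" "x \<in> V" "y \<in> V" for x y
  proof -
    obtain e where e: "e \<in> E" "f ` e = f ` {x, y}"
    proof -
      have "f ` {x, y} \<in> ?E" using \<open>{f x, f y} \<in> ?E\<close> by simp
      then obtain e where "e \<in> E" "f ` {x, y} = f ` e" by (rule imageE)
      with that show ?thesis by simp
    qed
    have "e \<subseteq> V" "{x, y} \<subseteq> V" using e(1) EV \<open>x \<in> V\<close> \<open>y \<in> V\<close> by auto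
    then have "e = {x, y}"
      using inj_on_image_eq_iff[OF f, of e "{x, y}"] e(2) by simp
    then show ?thesis using e by simp
  qed
  have "\<not> contains_C4 ?E"
  proof
    assume "contains_C4 ?E"
    then obtain a b c d where d: "distinct [a, b, c, d]"
      and E: "{a, b} \<in> ?E" "{b, c} \<in> ?E" "{c, d} \<in> ?E" "{d, a} \<in> ?E"
      unfolding contains_C4_def by (elim exE conjE) (simp only: insert_subset)
    obtain x y where xy: "x \<in> V" "y \<in> V" "a = f x" "b = f y" using edge[OF E(1)] by blast
    obtain z w where zw: "z \<in> V" "w \<in> V" "c = f z" "d = f w" using edge[OF E(3)] by blast
    have "{x, y} \<in> E" "{y, z} \<in> E" "{z, w} \<in> E" "{w, x} \<in> E"
      by (rule pull; use E xy zw in \<open>simp only:\<close>)+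
    then have "{{x, y}, {y, z}, {z, w}, {w, x}} \<subseteq> E" by simp
    moreover have "distinct [x, y, z, w]" using d xy zw by auto
    ultimately have "contains_C4 E"
      unfolding contains_C4_def by (intro exI conjI)
    then show False using free by simp
  qed
  then have "card ?E \<in> C4_free_sizes (card V)"
    using G' card_image[OF f] unfolding C4_free_sizes_def by blast
  then show ?thesis
    using Max_ge[OF finite_C4_free_sizes] by (simp add: ex_C4_def cardE)
qed

definition lower_density :: "nat set \<Rightarrow> ereal" where
  "lower_density N = liminf (\<lambda>x. ereal (real (card (N \<inter> {1..x})) / real x))"

end

theory Submission
  imports Defs
begin

text \<open>
  Let \<open>s = sqrt n\<close> and call two distinct vertices uncovered if they have no common neighbour.
  Counting cherries shows that if a \<open>C\<^sub>4\<close>-free graph has more than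
  \<open>n powr (3/2) / 2 + (1/4 - \<epsilon>) n\<close> edges, then the sum of \<open>(d v - s)\<^sup>2\<close> over all \<open>v\<close> plus the number
  of uncovered ordered pairs is at most \<open>4 \<epsilon> s n\<close>. For non-adjacent \<open>u\<close>, \<open>v\<close>, following the covered
  pairs \<open>(u, w)\<close> with \<open>w\<close> a neighbour of \<open>v\<close> embeds almost all of the neighbourhood of \<open>v\<close> into that
  of \<open>u\<close>; the loss is on average only \<open>O(\<epsilon>)\<close>. Hence the sum of \<open>\<bar>d u - d v\<bar>\<close> over all pairs is
  \<open>O(\<epsilon> n\<^sup>2)\<close>, so the average degree, which lies in \<open>[s + 1/2 - 2\<epsilon>, s + 1/2]\<close>, is within \<open>O(\<epsilon>)\<close>
  of the degree of some vertex, an integer. This fails whenever \<open>s\<close> is close to an integer.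
\<close>

section \<open>Neighbourhood systems with codegrees at most one, and double counting\<close>

locale C4_free_neighbourhoods =
  fixes V :: "'a set" and N :: "'a \<Rightarrow> 'a set"
  assumes finite_V: "finite V"
    and N_subset: "N v \<subseteq> V"
    and N_sym: "u \<in> N v \<longleftrightarrow> v \<in> N u"
    and codegree_le_1: "u \<noteq> v \<Longrightarrow> card (N u \<inter> N v) \<le> 1"
begin

definition d :: "'a \<Rightarrow> real" where
  "d v = real (card (N v))"

definition uncovered :: "'a \<Rightarrow> 'a set" where
  "uncovered u = {v \<in> V. v \<noteq> u \<and> N u \<inter> N v = {}}"

definition defect :: "'a \<Rightarrow> real" where
  "defect v = real (card (uncovered v))"

abbreviation "n \<equiv> real (card V)"

lemma finite_N: "finite (N v)"
  using finite_subset[OF N_subset finite_V] .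

lemma uncovered_subset: "uncovered u \<subseteq> V"
  by (auto simp: uncovered_def)

lemma uncovered_sym: "u \<in> V \<Longrightarrow> v \<in> V \<Longrightarrow> u \<in> uncovered v \<longleftrightarrow> v \<in> uncovered u"
  by (auto simp: uncovered_def)

lemma defect_nonneg: "0 \<le> defect v"
  by (simp add: defect_def)

lemma defect_le: "defect v \<le> n"
  unfolding defect_def using card_mono[OF finite_V uncovered_subset] by simp

text \<open>Serves two symmetric relations: adjacency \<open>N\<close> and
  \<open>uncovered\<close>.\<close>

lemma sum_swap_symmetric:
  fixes g :: "'a \<Rightarrow> 'a \<Rightarrow> real"
  assumes "\<And>v. R v \<subseteq> V" and "\<And>u v. u \<in> V \<Longrightarrow> v \<in> V \<Longrightarrow> u \<in> R v \<longleftrightarrow> v \<in> R u"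
  shows "(\<Sum>v\<in>V. \<Sum>w\<in>R v. g v w) = (\<Sum>w\<in>V. \<Sum>v\<in>R w. g v w)"
proof -
  have R: "R v = {w. w \<in> V \<and> w \<in> R v}" for v using assms(1) by blast
  have "(\<Sum>v\<in>V. \<Sum>w\<in>R v. g v w) = (\<Sum>v\<in>V. \<Sum>w | w \<in> V \<and> w \<in> R v. g v w)"
    using R by simp
  also have "\<dots> = (\<Sum>w\<in>V. \<Sum>v | v \<in> V \<and> w \<in> R v. g v w)"
    by (rule sum.swap_restrict[OF finite_V finite_V])
  also have "\<dots> = (\<Sum>w\<in>V. \<Sum>v\<in>R w. g v w)"
    using assms by (intro sum.cong) auto
  finally show ?thesis .
qed

lemma sum_N: "(\<Sum>v\<in>V. \<Sum>w\<in>N v. g w) = (\<Sum>w\<in>V. d w * g w)" for g :: "'a \<Rightarrow> real"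
  using sum_swap_symmetric[of N "\<lambda>v w. g w"] N_subset N_sym by (simp add: d_def)

lemma card_Int_sum: "A \<subseteq> V \<Longrightarrow> real (card (A \<inter> B)) = (\<Sum>w\<in>A. of_bool (w \<in> B))"
  by (metis finite_V finite_subset sum_of_bool_eq Collect_mem_eq)

text \<open>Sum \<open>card (N u \<inter> N v)\<close> over all ordered pairs. Sorting by the common
  neighbour gives the squares of the degrees; sorting by pairs, the diagonal gives the degrees and
  every other pair gives 1 unless it is uncovered.\<close>

lemma cherry_count: "(\<Sum>v\<in>V. (d v)\<^sup>2) + (\<Sum>v\<in>V. defect v) = n\<^sup>2 - n + (\<Sum>v\<in>V. d v)"
proof -
  have pair: "real (card (N u \<inter> N v)) =
      of_bool (u = v) * (d u - 1) + 1 - of_bool (v \<in> uncovered u)" if "v \<in> V" for u v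
  proof (cases "u = v")
    case False
    have "card (N u \<inter> N v) = 0 \<longleftrightarrow> N u \<inter> N v = {}" using finite_N by simp
    then show ?thesis using False that codegree_le_1[OF False] by (auto simp: uncovered_def)
  qed (auto simp: d_def uncovered_def)
  have "(\<Sum>v\<in>V. real (card (N u \<inter> N v))) = d u - 1 + n - defect u" if "u \<in> V" for u
  proof -
    have "defect u = (\<Sum>v\<in>V. of_bool (v \<in> uncovered u))"
      using card_Int_sum[of V "uncovered u"] uncovered_subset
      by (simp add: defect_def Int_absorb1)
    then show ?thesis using that finite_V
      by (simp add: pair sum.distrib sum_subtractf of_bool_def if_distrib[of "\<lambda>x. x * _"] cong: if_cong)
  qed
  then have "(\<Sum>u\<in>V. \<Sum>v\<in>V. real (card (N u \<inter> N v))) = (\<Sum>u\<in>V. d u - 1 + n - defect u)"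
    by simp
  moreover have "(\<Sum>u\<in>V. \<Sum>v\<in>V. real (card (N u \<inter> N v))) = (\<Sum>v\<in>V. (d v)\<^sup>2)"
  proof -
    have "(\<Sum>v\<in>V. real (card (N u \<inter> N v))) = (\<Sum>w\<in>N u. d w)" for u
    proof -
      have "(\<Sum>v\<in>V. real (card (N u \<inter> N v))) = (\<Sum>v\<in>V. \<Sum>w\<in>N u. of_bool (v \<in> N w))"
        by (intro sum.cong refl) (subst card_Int_sum[OF N_subset], simp add: N_sym)
      also have "\<dots> = (\<Sum>w\<in>N u. \<Sum>v\<in>V. of_bool (v \<in> N w))" by (rule sum.swap)
      also have "\<dots> = (\<Sum>w\<in>N u. d w)"
        using card_Int_sum[of V] N_subset by (simp add: d_def Int_absorb1 flip: card_Int_sum)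
      finally show ?thesis .
    qed
    then show ?thesis by (simp add: sum_N power2_eq_square)
  qed
  ultimately show ?thesis by (simp add: sum.distrib sum_subtractf power2_eq_square algebra_simps)
qed

section \<open>Comparing the degrees of different vertices\<close>

text \<open>Send each neighbour \<open>w\<close> of \<open>v\<close> covered by \<open>u\<close> to
  a common neighbour \<open>x w\<close> of \<open>u\<close> and \<open>w\<close>. Two such
  \<open>w\<close> with the same image would both be common neighbours of \<open>x w\<close> and
  \<open>v\<close>; non-adjacency of \<open>u\<close> and \<open>v\<close> guarantees that
  \<open>x w\<close> differs from \<open>v\<close>.\<close>

lemma degree_le:
  assumes "v \<in> V" "u \<in> V" "u \<noteq> v" "u \<notin> N v"
  shows "d v \<le> d u + real (card (uncovered u \<inter> N v))"
proof -
  define W where "W = N v - uncovered u"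
  have "\<exists>x. x \<in> N u \<inter> N w" if "w \<in> W" for w
    using that assms N_subset unfolding W_def uncovered_def by blast
  then obtain x where x: "\<And>w. w \<in> W \<Longrightarrow> x w \<in> N u \<inter> N w" by metis
  have "inj_on x W"
  proof (rule inj_onI, rule ccontr)
    fix w w' assume w: "w \<in> W" "w' \<in> W" "x w = x w'" "w \<noteq> w'"
    have "x w \<noteq> v" using x[OF w(1)] assms(4) N_sym by blast
    have "{w, w'} \<subseteq> N (x w) \<inter> N v"
      using x[OF w(1)] x[OF w(2)] w by (auto simp: W_def intro: N_sym[THEN iffD1])
    then have "card {w, w'} \<le> card (N (x w) \<inter> N v)" by (intro card_mono) (auto simp: finite_N)
    then show False using codegree_le_1[OF \<open>x w \<noteq> v\<close>] w(4) by simp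
  qed
  then have "card W \<le> card (N u)"
    using x by (intro card_inj_on_le[of x]) (auto simp: finite_N)
  moreover have "card (N v) \<le> card W + card (uncovered u \<inter> N v)"
    using card_Un_le[of W "uncovered u \<inter> N v"] by (simp add: W_def Un_Diff_Int Int_commute)
  ultimately show ?thesis by (simp add: d_def)
qed

text \<open>Non-adjacent pairs are handled by \<open>degree_le\<close> in both directions, adjacent
  pairs by the triangle inequality through \<open>s\<close>. Here \<open>s\<close> is any real; it
  is later the square root of the order.\<close>

lemma sum_degree_diff:
  "(\<Sum>u\<in>V. \<Sum>v\<in>V. \<bar>d u - d v\<bar>) \<le> 2 * (\<Sum>v\<in>V. defect v * d v) + 2 * (\<Sum>v\<in>V. d v * \<bar>d v - s\<bar>)"
proof -
  let ?Z = "\<lambda>u v. real (card (uncovered u \<inter> N v))"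
  have 1: "\<bar>d u - d v\<bar> \<le> (?Z u v + ?Z v u) + of_bool (v \<in> N u) * (\<bar>d u - s\<bar> + \<bar>d v - s\<bar>)"
    if "u \<in> V" "v \<in> V" for u v
  proof (cases "u = v \<or> v \<in> N u")
    case False
    then show ?thesis
      using degree_le[of v u] degree_le[of u v] that N_sym[of u v] by auto
  qed auto
  have "(\<Sum>v\<in>V. ?Z u v) = (\<Sum>w\<in>uncovered u. d w)" for u
  proof -
    have "(\<Sum>v\<in>V. ?Z u v) = (\<Sum>v\<in>V. \<Sum>w\<in>uncovered u. of_bool (v \<in> N w))"
      by (intro sum.cong refl) (subst card_Int_sum[OF uncovered_subset], simp add: N_sym)
    also have "\<dots> = (\<Sum>w\<in>uncovered u. \<Sum>v\<in>V. of_bool (v \<in> N w))" by (rule sum.swap)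
    also have "\<dots> = (\<Sum>w\<in>uncovered u. d w)"
      using N_subset by (simp add: d_def Int_absorb1 flip: card_Int_sum)
    finally show ?thesis .
  qed
  \<comment> \<open>By symmetry of \<open>uncovered\<close>, each \<open>d w\<close> is counted once
    for every \<open>u\<close> uncovered by \<open>w\<close>, that is \<open>defect w\<close>
    times.\<close>
  then have 2: "(\<Sum>u\<in>V. \<Sum>v\<in>V. ?Z u v) = (\<Sum>v\<in>V. defect v * d v)"
    using sum_swap_symmetric[of uncovered "\<lambda>v w. d w"] uncovered_subset uncovered_sym
    by (simp add: defect_def)
  have 3: "(\<Sum>u\<in>V. \<Sum>v\<in>V. ?Z v u) = (\<Sum>v\<in>V. defect v * d v)"
    by (subst sum.swap) (rule 2)
  have "(\<Sum>v\<in>V. of_bool (v \<in> N u) * g v) = (\<Sum>v\<in>N u. g v)" for u and g :: "'a \<Rightarrow> real"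
    using N_subset finite_V
    by (simp add: of_bool_def if_distrib[of "\<lambda>x. x * _"] sum.If_cases Int_absorb1 cong: if_cong)
  then have "(\<Sum>u\<in>V. \<Sum>v\<in>V. of_bool (v \<in> N u) * (\<bar>d u - s\<bar> + \<bar>d v - s\<bar>))
      = 2 * (\<Sum>v\<in>V. d v * \<bar>d v - s\<bar>)"
    by (simp add: sum.distrib sum_N) (simp add: d_def)
  moreover have "(\<Sum>u\<in>V. \<Sum>v\<in>V. \<bar>d u - d v\<bar>) \<le> (\<Sum>u\<in>V. \<Sum>v\<in>V.
      (?Z u v + ?Z v u) + of_bool (v \<in> N u) * (\<bar>d u - s\<bar> + \<bar>d v - s\<bar>))"
    using 1 by (intro sum_mono) auto
  ultimately show ?thesis using 2 3 by (simp add: sum.distrib)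
qed

section \<open>The degree sum when the order is slightly above a square\<close>

text \<open>If the bound failed, the average degree would lie in the interval from
  \<open>k + 0.48\<close> to \<open>k + 0.75\<close>, so every degree would be far from it. Then the
  degree differences would sum to at least \<open>0.23 * n\<^sup>2\<close>, whereas
  \<open>sum_degree_diff\<close> allows only about \<open>0.17 * n\<^sup>2\<close>.\<close>

lemma degree_sum_bound:
  fixes k :: nat
  assumes k: "200 \<le> k" and n: "k\<^sup>2 \<le> card V" "2 * card V \<le> 2 * k\<^sup>2 + k"
  shows "(\<Sum>v\<in>V. d v) \<le> n * (sqrt n + 1/2 - 1/50)"
proof (rule ccontr)
  define s where "s = sqrt n"
  define S where "S = (\<Sum>v\<in>V. d v)"
  define F where "F = (\<Sum>v\<in>V. defect v)"
  define Q where "Q = (\<Sum>v\<in>V. (d v - s)\<^sup>2)"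
  assume "\<not> ?thesis"
  then have S: "n * (s + 1/2 - 1/50) < S" by (simp add: s_def S_def)
  have ss: "s * s = n" by (simp add: s_def)
  have "real (k\<^sup>2) \<le> n" "real (2 * card V) \<le> real (2 * k\<^sup>2 + k)" using n by (simp_all only: of_nat_le_iff)
  then have kn: "(real k)\<^sup>2 \<le> n" "n \<le> (real k)\<^sup>2 + real k / 2" by simp_all
  \<comment> \<open>The window of length \<open>k / 2\<close> is chosen to keep \<open>s\<close>
    within 1/4 above \<open>k\<close>.\<close>
  have "(real k)\<^sup>2 + real k / 2 \<le> (real k + 1/4)\<^sup>2" by (simp add: power2_eq_square algebra_simps)
  then have s: "real k \<le> s" "s \<le> real k + 1/4"
    using kn unfolding s_def by (auto intro: real_le_rsqrt real_le_lsqrt)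
  then have s200: "200 \<le> s" using k by simp
  have npos: "0 < n" using s200 ss by (metis mult_pos_pos less_le_trans zero_less_numeral)
  have "Q = (\<Sum>v\<in>V. (d v)\<^sup>2) - 2 * s * S + n * n"
  proof -
    have "(d v - s)\<^sup>2 = (d v)\<^sup>2 - 2 * s * d v + n" for v
      using ss by (simp add: power2_eq_square algebra_simps)
    then show ?thesis
      by (simp add: Q_def S_def sum.distrib sum_subtractf sum_distrib_left)
  qed
  then have QF: "Q + F = 2 * n * n - n - (2 * s - 1) * S"
    using cherry_count unfolding F_def S_def by (simp add: power2_eq_square algebra_simps)
  have Q0: "0 \<le> Q" and F0: "0 \<le> F"
    unfolding Q_def F_def by (simp_all add: sum_nonneg defect_nonneg)
  \<comment> \<open>The summand 1/2 cancels the other terms linear in \<open>s\<close>, so only the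
    deviation 1/50 survives at order \<open>s * n\<close>.\<close>
  have "(2 * s - 1) * (n * (s + 1/2 - 1/50)) \<le> (2 * s - 1) * S"
    using S s200 by (intro mult_left_mono) auto
  moreover have "(2 * s - 1) * (n * (s + 1/2 - 1/50)) = n * (2 * (s * s) - s / 25 - 1/2 + 1/50)"
    by (simp add: field_simps)
  ultimately have QFle: "Q + F \<le> s * n / 25"
    using QF ss npos by (simp add: algebra_simps)
  have Sle: "S \<le> n * (s + 1/2)"
  proof -
    have "(2 * s - 1) * S \<le> 2 * n * n - n" using QF Q0 F0 by simp
    also have "\<dots> \<le> n * (2 * (s * s) - 1/2)" using ss npos by (simp add: algebra_simps)
    also have "\<dots> = (2 * s - 1) * (n * (s + 1/2))" by (simp add: field_simps)
    finally show ?thesis using s200 by (simp add: mult_le_cancel_left)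
  qed
  have far: "n / 4 - n/50 \<le> (\<Sum>v\<in>V. \<bar>d u - d v\<bar>)" for u
  proof -
    have "\<bar>n * d u - S\<bar> = \<bar>\<Sum>v\<in>V. d u - d v\<bar>"
      by (simp add: sum_subtractf S_def)
    also have "\<dots> \<le> (\<Sum>v\<in>V. \<bar>d u - d v\<bar>)" by (rule sum_abs)
    finally have *: "\<bar>n * d u - S\<bar> \<le> (\<Sum>v\<in>V. \<bar>d u - d v\<bar>)" .
    \<comment> \<open>Integrality enters here: a degree is at most \<open>k \<le> s\<close> or at
      least \<open>k + 1 \<ge> s + 3/4\<close>, while the average lies between
      \<open>s + 0.48\<close> and \<open>s + 1/2\<close>.\<close>
    consider "card (N u) \<le> k" | "k + 1 \<le> card (N u)" by linarith
    then show ?thesis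
    proof cases
      case 1
      then have "n * d u \<le> n * s" using s npos by (intro mult_left_mono) (auto simp: d_def)
      moreover have "n * (s + 1/2 - 1/50) = n * s + n / 2 - n / 50" by (simp add: algebra_simps)
      ultimately show ?thesis using * S npos by linarith
    next
      case 2
      then have "real k + 1 \<le> d u" by (simp add: d_def)
      then have "n * (s + 3/4) \<le> n * d u" using s npos by (intro mult_left_mono) auto
      moreover have "n * (s + 3/4) = n * (s + 1/2) + n / 4" by (simp add: algebra_simps)
      ultimately show ?thesis using * Sle npos by linarith
    qed
  qed
  have "n * (n / 4 - n / 50) \<le> (\<Sum>u\<in>V. \<Sum>v\<in>V. \<bar>d u - d v\<bar>)"
    using sum_bounded_below[of V "n / 4 - n / 50"] far by simp
  also have "\<dots> \<le> 2 * (\<Sum>v\<in>V. defect v * d v) + 2 * (\<Sum>v\<in>V. d v * \<bar>d v - s\<bar>)"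
    by (rule sum_degree_diff)
  also have "(\<Sum>v\<in>V. defect v * d v) \<le> 2 * s * F + s / 4 * Q"
  proof -
    \<comment> \<open>Degrees up to \<open>2 * s\<close> are paid for by the first term. The excess
      over \<open>2 * s\<close> is at most \<open>(d v - s)\<^sup>2 / (4 * s)\<close>, and
      \<open>defect v \<le> s * s\<close>.\<close>
    have "defect v * d v \<le> 2 * s * defect v + s / 4 * (d v - s)\<^sup>2" for v
    proof -
      have "0 \<le> (d v - s - 2 * s)\<^sup>2" by simp
      then have "4 * s * (d v - 2 * s) \<le> (d v - s)\<^sup>2"
        by (simp add: power2_eq_square algebra_simps)
      then have "defect v * (4 * s * (d v - 2 * s)) \<le> defect v * (d v - s)\<^sup>2"
        using defect_nonneg by (intro mult_left_mono)
      also have "\<dots> \<le> (s * s) * (d v - s)\<^sup>2"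
        using defect_le ss by (intro mult_right_mono) auto
      finally have "(4 * s) * (defect v * d v) \<le> (4 * s) * (2 * s * defect v + s / 4 * (d v - s)\<^sup>2)"
        by (simp add: algebra_simps)
      then show ?thesis using s200 by (simp add: mult_le_cancel_left)
    qed
    then have "(\<Sum>v\<in>V. defect v * d v) \<le> (\<Sum>v\<in>V. 2 * s * defect v + s / 4 * (d v - s)\<^sup>2)"
      by (intro sum_mono)
    then show ?thesis by (simp add: F_def Q_def sum.distrib sum_distrib_left)
  qed
  also have "2 * s * F + s / 4 * Q \<le> 2 * s * (s * n / 25)"
  proof -
    have "s / 4 * Q \<le> 2 * s * Q" using Q0 s200 by (intro mult_right_mono) auto
    then have "2 * s * F + s / 4 * Q \<le> 2 * s * (Q + F)" by (simp add: algebra_simps)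
    also have "\<dots> \<le> 2 * s * (s * n / 25)" using QFle s200 by (intro mult_left_mono) auto
    finally show ?thesis .
  qed
  also have "2 * (\<Sum>v\<in>V. d v * \<bar>d v - s\<bar>) \<le> (\<Sum>v\<in>V. (d v)\<^sup>2) / 100 + 100 * Q"
  proof -
    \<comment> \<open>The weights make the squared degrees cost only about
      \<open>n\<^sup>2 / 100\<close>, while \<open>100 * Q\<close> is at most
      \<open>4 * s * n\<close>, of lower order.\<close>
    have "2 * (d v * \<bar>d v - s\<bar>) \<le> (d v)\<^sup>2 / 100 + 100 * (d v - s)\<^sup>2" for v
    proof -
      have "0 \<le> (d v / 10 - 10 * \<bar>d v - s\<bar>)\<^sup>2" by simp
      also have "\<dots> = (d v)\<^sup>2 / 100 + 100 * (d v - s)\<^sup>2 - 2 * (d v * \<bar>d v - s\<bar>)"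
        by (simp add: power2_diff power_mult_distrib power_divide)
      finally show ?thesis by simp
    qed
    then have "(\<Sum>v\<in>V. 2 * (d v * \<bar>d v - s\<bar>)) \<le> (\<Sum>v\<in>V. (d v)\<^sup>2 / 100 + 100 * (d v - s)\<^sup>2)"
      by (intro sum_mono)
    then show ?thesis by (simp add: Q_def sum.distrib sum_distrib_left sum_divide_distrib)
  qed
  also have "(\<Sum>v\<in>V. (d v)\<^sup>2) / 100 + 100 * Q \<le> (n * n + n * (s + 1/2)) / 100 + 4 * (s * n)"
  proof -
    have "(\<Sum>v\<in>V. (d v)\<^sup>2) + F = n * n - n + S"
      using cherry_count by (simp add: S_def F_def power2_eq_square)
    then have "(\<Sum>v\<in>V. (d v)\<^sup>2) \<le> n * n + n * (s + 1/2)"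
      using Sle F0 npos by linarith
    moreover have "Q \<le> s * n / 25" using QFle F0 by linarith
    ultimately show ?thesis by (intro add_mono divide_right_mono) auto
  qed
  finally have "n * (n / 4 - n / 50) \<le>
      2 * (2 * s * (s * n / 25)) + ((n * n + n * (s + 1/2)) / 100 + 4 * (s * n))" by simp
  also have "\<dots> = n * (4 * (s * s) / 25 + n / 100 + s / 100 + 1/200 + 4 * s)"
    by (simp add: field_simps)
  finally have "n / 4 - n / 50 \<le> 4 * (s * s) / 25 + n / 100 + s / 100 + 1/200 + 4 * s"
    using npos by (simp add: mult_le_cancel_left)
  \<comment> \<open>What remains is \<open>0.23 * n \<le> 0.17 * n + 4.01 * s + 1/200\<close>, but
    \<open>0.06 * n \<ge> 12 * s\<close>.\<close>
  moreover have "200 * s \<le> n" using s200 ss mult_right_mono[OF s200, of s] by simp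
  ultimately show False using s200 unfolding ss by linarith
qed

end

section \<open>From graphs to neighbourhood systems\<close>

lemma sum_degrees:
  assumes "simple_graph V E"
  shows "(\<Sum>v\<in>V. card {u. {v, u} \<in> E}) = 2 * card E"
proof -
  have fin: "finite V" "finite E" and E: "\<And>e. e \<in> E \<Longrightarrow> e \<subseteq> V \<and> card e = 2"
    using assms simple_graph_edges(2)[OF assms] by (auto simp: simple_graph_def)
  have "card {u. {v, u} \<in> E} = card {e \<in> E. v \<in> e}" for v
  proof (rule bij_betw_same_card[of "\<lambda>u. {v, u}"])
    show "bij_betw (\<lambda>u. {v, u}) {u. {v, u} \<in> E} {e \<in> E. v \<in> e}"
    proof (rule bij_betw_imageI)
      show "inj_on (\<lambda>u. {v, u}) {u. {v, u} \<in> E}" by (auto simp: inj_on_def doubleton_eq_iff)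
      show "(\<lambda>u. {v, u}) ` {u. {v, u} \<in> E} = {e \<in> E. v \<in> e}"
      proof (intro set_eqI iffI)
        fix e assume e: "e \<in> {e \<in> E. v \<in> e}"
        then obtain a b where "e = {a, b}" using E by (metis CollectD card_2_iff)
        then have "e = {v, a} \<or> e = {v, b}" using e by auto
        then show "e \<in> (\<lambda>u. {v, u}) ` {u. {v, u} \<in> E}" using e by auto
      qed auto
    qed
  qed
  then have "(\<Sum>v\<in>V. card {u. {v, u} \<in> E}) = (\<Sum>v\<in>V. card {e \<in> E. v \<in> e})" by simp
  also have "\<dots> = 2 * card E"
  proof (rule sum_multicount[OF fin])
    have "{v \<in> V. v \<in> e} = e" if "e \<in> E" for e using E[OF that] by blast
    then show "\<forall>e\<in>E. card {v \<in> V. v \<in> e} = 2" using E by simp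
  qed
  finally show ?thesis .
qed

text \<open>Two common neighbours \<open>x\<close>, \<open>y\<close> of \<open>u\<close> and
  \<open>v\<close> close the four-cycle \<open>u\<close>, \<open>x\<close>, \<open>v\<close>,
  \<open>y\<close>; its vertices are distinct since there are no loops.\<close>

lemma C4_free_neighbourhoods_graph:
  assumes "simple_graph V E" and "\<not> contains_C4 E"
  shows "C4_free_neighbourhoods V (\<lambda>v. {u. {v, u} \<in> E})"
proof
  have E: "\<And>e. e \<in> E \<Longrightarrow> e \<subseteq> V \<and> card e = 2"
    using assms(1) by (auto simp: simple_graph_def)
  show fin: "finite V" using assms(1) by (simp add: simple_graph_def)
  show sub: "{u. {v, u} \<in> E} \<subseteq> V" for v using E by blast
  show "u \<in> {u. {v, u} \<in> E} \<longleftrightarrow> v \<in> {v. {u, v} \<in> E}" for u v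
    by (simp add: insert_commute)
  have loop: "{v, v} \<notin> E" for v using E[of "{v, v}"] by auto
  fix u v :: 'a assume "u \<noteq> v"
  let ?W = "{w. {u, w} \<in> E} \<inter> {w. {v, w} \<in> E}"
  show "card ?W \<le> 1"
  proof (rule ccontr)
    assume "\<not> card ?W \<le> 1"
    moreover have "finite ?W" using finite_subset[OF sub fin] by blast
    ultimately obtain x y where xy: "x \<in> ?W" "y \<in> ?W" "x \<noteq> y"
      using card_le_Suc0_iff_eq[of ?W] by auto
    then have edges: "{u, x} \<in> E" "{x, v} \<in> E" "{v, y} \<in> E" "{y, u} \<in> E"
      by (auto simp: insert_commute)
    moreover have "distinct [u, x, v, y]"
      using edges loop xy(3) \<open>u \<noteq> v\<close> by auto
    ultimately show False using assms(2) unfolding contains_C4_def by blast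
  qed
qed

text \<open>Apply \<open>degree_sum_bound\<close> to an extremal graph; halving the degree sum turns
  the gain 1/50 into 1/100.\<close>

lemma ex_C4_le:
  assumes k: "200 \<le> k" and n: "k\<^sup>2 \<le> n" "2 * n \<le> 2 * k\<^sup>2 + k"
  shows "real (ex_C4 n) \<le> 1/2 * real n powr (3/2) + (1/4 - 1/100) * real n"
proof -
  have "ex_C4 n \<in> C4_free_sizes n"
    unfolding ex_C4_def using finite_C4_free_sizes C4_free_sizes_nonempty by (rule Max_in)
  then obtain V :: "nat set" and E where G: "simple_graph V E" "\<not> contains_C4 E"
    and VE: "card V = n" "card E = ex_C4 n"
    unfolding C4_free_sizes_def by auto
  interpret C4_free_neighbourhoods V "\<lambda>v. {u. {v, u} \<in> E}"
    by (rule C4_free_neighbourhoods_graph[OF G])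
  have "(\<Sum>v\<in>V. d v) = real (\<Sum>v\<in>V. card {u. {v, u} \<in> E})" by (simp add: d_def)
  also have "\<dots> = 2 * real (ex_C4 n)" by (simp add: sum_degrees[OF G(1)] VE)
  finally have "2 * real (ex_C4 n) \<le> real n * (sqrt (real n) + 1/2 - 1/50)"
    using degree_sum_bound[of k] k n VE by simp
  moreover have "real n powr (3/2) = real n * sqrt (real n)"
    using powr_add[of "real n" 1 "1/2"] by (simp add: powr_half_sqrt)
  ultimately show ?thesis by (simp add: algebra_simps)
qed

section \<open>Lower density of the admissible orders\<close>

text \<open>The windows fill about a quarter of each gap between consecutive squares. A crude
  constant suffices: use only \<open>k\<close> from \<open>m\<close> to \<open>2 * m - 1\<close>,
  where \<open>m\<close> is about half the square root of \<open>x\<close>, and the first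
  \<open>m div 2 + 1\<close> elements of each window.\<close>

lemma lower_density_near_squares:
  "lower_density {n. \<exists>k\<ge>k0. k\<^sup>2 \<le> n \<and> 2 * n \<le> 2 * k\<^sup>2 + k} > 0"
proof -
  let ?N = "{n. \<exists>k\<ge>k0. k\<^sup>2 \<le> n \<and> 2 * n \<le> 2 * k\<^sup>2 + k}"
  have "1/32 \<le> real (card (?N \<inter> {1..x})) / real x" if x: "(2 * (k0 + 1))\<^sup>2 \<le> x" for x
  proof -
    define m where "m = nat \<lfloor>sqrt (real x) / 2\<rfloor>"
    have "real m \<le> sqrt (real x) / 2" "sqrt (real x) / 2 < real m + 1"
    proof -
    have "real m = of_int \<lfloor>sqrt (real x) / 2\<rfloor>" by (simp add: m_def)
    then show "real m \<le> sqrt (real x) / 2" "sqrt (real x) / 2 < real m + 1" by linarith+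
  qed
    then have "(2 * real m)\<^sup>2 \<le> (sqrt (real x))\<^sup>2" "(sqrt (real x))\<^sup>2 < (2 * (real m + 1))\<^sup>2"
      by (intro power_mono power_strict_mono; simp)+
    then have "real ((2 * m)\<^sup>2) \<le> real x" "real x < real ((2 * (m + 1))\<^sup>2)"
      by (simp_all add: add.commute)
    then have mx: "(2 * m)\<^sup>2 \<le> x" "x < (2 * (m + 1))\<^sup>2" by (simp_all only: of_nat_le_iff of_nat_less_iff)
    have "2 * (k0 + 1) < 2 * (m + 1)"
      using power_less_imp_less_base[of "2 * (k0 + 1)" 2 "2 * (m + 1)"] x mx(2) by simp
    then have m: "k0 + 1 \<le> m" by simp
    define g where "g = (\<lambda>(k, i). k\<^sup>2 + i :: nat)"
    let ?A = "{m..<2 * m} \<times> {..m div 2}"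
    have "inj_on g ?A"
    proof (rule inj_onI)
      fix p q assume pq: "p \<in> ?A" "q \<in> ?A" "g p = g q"
      obtain k i l j where p: "p = (k, i)" and q: "q = (l, j)" by (cases p, cases q)
      \<comment> \<open>Windows of different \<open>k\<close> are disjoint: an offset of at most
        \<open>a / 2\<close> does not reach the next square.\<close>
      have less: False if "a\<^sup>2 + b = c\<^sup>2 + e" "a < c" "m \<le> a" "b \<le> m div 2" for a b c e :: nat
      proof -
        have "(Suc a)\<^sup>2 \<le> c\<^sup>2" using that by (intro power_mono) auto
        then show False using that by (simp add: power2_eq_square)
      qed
      have "k = l" using less[of k i l j] less[of l j k i] pq p q
        by (cases k l rule: linorder_cases) (auto simp: g_def)
      then show "p = q" using pq p q by (simp add: g_def)
    qed
    moreover have "g ` ?A \<subseteq> ?N \<inter> {1..x}"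
    proof
      fix y assume "y \<in> g ` ?A"
      then obtain k i where ki: "m \<le> k" "Suc k \<le> 2 * m" "i \<le> m div 2" "y = k\<^sup>2 + i"
        by (auto simp: g_def)
      then have "2 * y \<le> 2 * k\<^sup>2 + k" by simp
      moreover have "(Suc k)\<^sup>2 \<le> (2 * m)\<^sup>2" using ki by (intro power_mono) auto
      then have "y \<le> x" using ki mx by (simp add: power2_eq_square)
      moreover have "0 < k\<^sup>2" using ki m by simp
      then have "1 \<le> y" using ki by linarith
      ultimately show "y \<in> ?N \<inter> {1..x}" using ki m by (auto intro!: exI[of _ k])
    qed
    ultimately have "card ?A \<le> card (?N \<inter> {1..x})"
      by (intro card_inj_on_le[of g]) auto
    then have "m * (m div 2 + 1) \<le> card (?N \<inter> {1..x})" by (simp add: card_cartesian_product)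
    \<comment> \<open>The constant 1/32 combines at least \<open>m\<^sup>2 / 2\<close> elements
      found with \<open>x \<le> 16 * m\<^sup>2\<close>.\<close>
    moreover have "m * m \<le> m * (2 * (m div 2 + 1))" by (intro mult_left_mono) auto
    ultimately have "m * m \<le> 2 * card (?N \<inter> {1..x})" by simp
    moreover have "(2 * (m + 1))\<^sup>2 \<le> (4 * m)\<^sup>2" using m by (intro power_mono) auto
    then have "x \<le> 16 * (m * m)" using mx by (simp add: power2_eq_square)
    ultimately have "x \<le> 32 * card (?N \<inter> {1..x})" by linarith
    then have "real x \<le> real (32 * card (?N \<inter> {1..x}))" by (simp only: of_nat_le_iff)
    moreover have "0 < x" using x by (metis add_is_0 gr0I le_zero_eq mult_is_0 power_eq_0_iff zero_neq_numeral zero_neq_one)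
    ultimately show ?thesis by (simp add: field_simps)
  qed
  then have "\<forall>\<^sub>F x in sequentially. ereal (1/32) \<le> ereal (real (card (?N \<inter> {1..x})) / real x)"
    by (auto simp only: eventually_sequentially ereal_less_eq)
  then have "ereal (1/32) \<le> lower_density ?N"
    unfolding lower_density_def by (rule Liminf_bounded)
  moreover have "(0 :: ereal) < ereal (1/32)" by simp
  ultimately show ?thesis by (rule less_le_trans[rotated])
qed

theorem theorem1p2:
  shows "\<exists>(\<epsilon>::real) (N::nat set). \<epsilon> > 0 \<and> N \<subseteq> {1..} \<and> lower_density N > 0 \<and>
    (\<forall>n\<in>N. real (ex_C4 n) \<le> 1 / 2 * real n powr (3 / 2) + (1 / 4 - \<epsilon>) * real n)"
proof (intro exI conjI)
  let ?N = "{n :: nat. \<exists>k\<ge>200. k\<^sup>2 \<le> n \<and> 2 * n \<le> 2 * k\<^sup>2 + k}"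
  show "(0 :: real) < 1/100" by simp
  show "?N \<subseteq> {1..}" by (force intro: order_trans[rotated])
  show "lower_density ?N > 0" by (rule lower_density_near_squares)
  show "\<forall>n\<in>?N. real (ex_C4 n) \<le> 1 / 2 * real n powr (3 / 2) + (1 / 4 - 1/100) * real n"
    using ex_C4_le by blast
qed

end
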